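(* Let $n\ge 1$ and let $\lambda=(\lambda_1,\dots,\lambda_l)$ be a partition of $n$, identified with its Young diagram. For each standard Young tableau $P$ of shape $\lambda$ let $$\mathfrak{h}_P(\mathbf{x})=\sum_{Q\in\mathfrak{st}_\lambda}\ \prod_{\alpha\in\lambda}x_{q_{P,Q}(\alpha)},$$ where $\mathfrak{st}_\lambda$ is the set of standard Young tableaux of shape $\lambda$, $q_{P,Q}$ is the $P$-pedestal of $Q$, and $\mathbf{x}=(x_0,x_1,x_2,\dots)$ are commuting variables. Then $\mathfrak{h}_P(\mathbf{x})$ does not depend on $P$: for all $P,P'\in\mathfrak{st}_\lambda$ one has $\mathfrak{h}_P(\mathbf{x})=\mathfrak{h}_{P'}(\mathbf{x})$.
   Context: A partition $\lambda=(\lambda_1\ge\dots\ge\lambda_l>0)$ of $n$ is identified with the set of nodes $(i,j)$ with $1\le i\le l$, $1\le j\le\lambda_i$. A standard Young tableau of shape $\lambda$ is a bijection $Q\colon\lambda\to\{1,\dots,n\}$ such that $Q(i,j)$ increases in $i$ and in $j$; the set of these is $\mathfrak{st}_\lambda$. For $Q\in\mathfrak{st}_\lambda$, the linear order $\preccurlyeq_Q$ on the nodes is given by $\alpha\prec_Q\beta$ iff $Q(\alpha)<Q(\beta)$. Given $P,Q\in\mathfrak{st}_\lambda$, let $\alpha_1\prec_Q\alpha_2\prec_Q\dots\prec_Q\alpha_n$ be the list of all nodes of $\lambda$ enumerated according to $\preccurlyeq_Q$. A node $\alpha_k$ (with $1\le k<n$) is called a $(P,Q)$-disagreement node if $\alpha_{k+1}\prec_P\alpha_k$.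 The $P$-pedestal of $Q$ is the function $q_{P,Q}\colon\lambda\to\mathbb{Z}_{\ge 0}$ defined by $$q_{P,Q}(\alpha_k)=\#\{\,l : l<k,\ \alpha_l\text{ is a }(P,Q)\text{-disagreement node}\,\}.$$ *)

theory Defs
  imports "HOL-Library.FuncSet" "HOL-Library.Poly_Mapping"
begin

definition is_partition :: "nat list \<Rightarrow> nat \<Rightarrow> bool" where
  "is_partition lam n \<longleftrightarrow>
     sorted_wrt (\<ge>) lam \<and> (\<forall>x\<in>set lam. 0 < x) \<and> sum_list lam = n"

type_synonym node = "nat \<times> nat"

(* Rows and columns are counted from 1, list positions from 0. *)
definition nodes :: "nat list \<Rightarrow> node set" where
  "nodes lam = {(i, j). 1 \<le> i \<and> i \<le> length lam \<and> 1 \<le> j \<and> j \<le> lam ! (i - 1)}"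

(* Extensionality fixes the junk values outside the diagram, so that elements of
   this set correspond exactly to bijections on the diagram; in particular the
   set is finite and summing over it is meaningful. *)
definition syt :: "nat list \<Rightarrow> (node \<Rightarrow> nat) set" where
  "syt lam = {Q. Q \<in> extensional (nodes lam) \<and>
     bij_betw Q (nodes lam) {1..sum_list lam} \<and>
     (\<forall>i i' j. (i, j) \<in> nodes lam \<longrightarrow> (i', j) \<in> nodes lam \<longrightarrow> i < i' \<longrightarrow> Q (i, j) < Q (i', j)) \<and>
     (\<forall>i j j'. (i, j) \<in> nodes lam \<longrightarrow> (i, j') \<in> nodes lam \<longrightarrow> j < j' \<longrightarrow> Q (i, j) < Q (i, j'))}"

definition prec :: "(node \<Rightarrow> nat) \<Rightarrow> node \<Rightarrow> node \<Rightarrow> bool" where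
  "prec Q a b \<longleftrightarrow> Q a < Q b"

(* As Q is a bijection onto {1..n}, the k-th node in the order given by Q
   (counting from 1) is the node carrying the entry k. *)
definition nth_node :: "nat list \<Rightarrow> (node \<Rightarrow> nat) \<Rightarrow> nat \<Rightarrow> node" where
  "nth_node lam Q k = inv_into (nodes lam) Q k"

definition disagreement_node ::
  "nat list \<Rightarrow> (node \<Rightarrow> nat) \<Rightarrow> (node \<Rightarrow> nat) \<Rightarrow> node \<Rightarrow> bool" where
  "disagreement_node lam P Q a \<longleftrightarrow>
     (\<exists>k. 1 \<le> k \<and> k < sum_list lam \<and> a = nth_node lam Q k \<and>
          prec P (nth_node lam Q (k + 1)) (nth_node lam Q k))"

(* The position of a in the enumeration by Q is Q a. *)
definition pedestal ::
  "nat list \<Rightarrow> (node \<Rightarrow> nat) \<Rightarrow> (node \<Rightarrow> nat) \<Rightarrow> node \<Rightarrow> nat" where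
  "pedestal lam P Q a =
     card {l. 1 \<le> l \<and> l < Q a \<and> disagreement_node lam P Q (nth_node lam Q l)}"

(* Integer polynomials in the variables x_0, x_1, x_2, ...: finitely supported
   functions from monomials (finitely supported exponent functions) to
   coefficients, with convolution as multiplication. *)
type_synonym ipoly = "(nat \<Rightarrow>\<^sub>0 nat) \<Rightarrow>\<^sub>0 int"

definition var :: "nat \<Rightarrow> ipoly" where
  "var i = Poly_Mapping.single (Poly_Mapping.single i 1) 1"

definition pedestal_poly :: "nat list \<Rightarrow> (node \<Rightarrow> nat) \<Rightarrow> ipoly" where
  "pedestal_poly lam P = (\<Sum>Q\<in>syt lam. \<Prod>a\<in>nodes lam. var (pedestal lam P Q a))"

end

theory Submission
  imports Defs
begin

text \<open>
  The monomial of \<open>Q\<close> depends only on its set of descents with respect to \<open>P\<close>, the positions of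
  the disagreement nodes. By inclusion-exclusion it suffices that for every finite \<open>S\<close> the number
  of \<open>Q\<close> with all descents in \<open>S\<close> does not depend on \<open>P\<close>. Cut the enumeration by \<open>Q\<close> after the
  positions in \<open>S\<close> and remember only the block of each node. Reordering every block by \<open>P\<close> again
  yields a standard tableau, because \<open>P\<close> is standard. Hence every block decomposition arises from
  exactly one \<open>Q\<close> with all descents in \<open>S\<close>, and the block decompositions do not refer to \<open>P\<close>.
\<close>

section \<open>Linear extensions, their descents and their blocks\<close>

definition lin_exts :: "'a set \<Rightarrow> ('a \<Rightarrow> 'a \<Rightarrow> bool) \<Rightarrow> ('a \<Rightarrow> nat) set" where
  "lin_exts V R = {Q \<in> extensional V. bij_betw Q V {1..card V} \<and>
     (\<forall>a\<in>V. \<forall>b\<in>V. R a b \<longrightarrow> Q a < Q b)}"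

definition descents :: "'a set \<Rightarrow> ('a \<Rightarrow> nat) \<Rightarrow> ('a \<Rightarrow> nat) \<Rightarrow> nat set" where
  "descents V P Q =
     {k. 1 \<le> k \<and> k < card V \<and> P (inv_into V Q (Suc k)) < P (inv_into V Q k)}"

text \<open>A cut \<open>s\<close> falls after position \<open>s\<close>, hence the strict
  inequality: \<open>s\<close> and \<open>Suc s\<close> lie in different blocks. For
  \<open>S\<close> the descent set, this is the pedestal value at position \<open>k\<close>.\<close>

definition level :: "nat set \<Rightarrow> nat \<Rightarrow> nat" where
  "level S k = card {s \<in> S. s < k}"

definition blocks :: "'a set \<Rightarrow> nat set \<Rightarrow> ('a \<Rightarrow> nat) \<Rightarrow> 'a \<Rightarrow> nat" where
  "blocks V S Q = restrict (\<lambda>a. level S (Q a)) V"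

text \<open>Sorts \<open>V\<close> by \<open>f\<close> with ties broken by \<open>P\<close>. The
  weak inequality makes \<open>a\<close> count itself, so positions start at 1.\<close>

definition lex_rank :: "'a set \<Rightarrow> ('a \<Rightarrow> nat) \<Rightarrow> ('a \<Rightarrow> nat) \<Rightarrow> 'a \<Rightarrow> nat" where
  "lex_rank V P f =
     restrict (\<lambda>a. card {b \<in> V. f b < f a \<or> f b = f a \<and> P b \<le> P a}) V"

lemma lin_extsD:
  assumes "Q \<in> lin_exts V R"
  shows "Q \<in> extensional V" and "bij_betw Q V {1..card V}" and "inj_on Q V"
    and "Q ` V = {1..card V}"
    and "\<And>a b. a \<in> V \<Longrightarrow> b \<in> V \<Longrightarrow> R a b \<Longrightarrow> Q a < Q b"
  using assms unfolding lin_exts_def bij_betw_def by blast+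

lemma finite_lin_exts:
  assumes "finite V"
  shows "finite (lin_exts V R)"
proof (rule finite_subset)
  show "lin_exts V R \<subseteq> V \<rightarrow>\<^sub>E {1..card V}"
    by (auto simp: lin_exts_def PiE_def bij_betw_def)
  show "finite (V \<rightarrow>\<^sub>E {1..card V})"
    using assms by (intro finite_PiE) auto
qed

lemma level_mono:
  assumes "finite S" "k \<le> l"
  shows "level S k \<le> level S l"
  unfolding level_def by (rule card_mono) (use assms in auto)

lemma level_less:
  assumes "finite S" "s \<in> S" "k \<le> s" "s < l"
  shows "level S k < level S l"
proof -
  have "{x \<in> S. x < k} \<subseteq> {x \<in> S. x < l}" using assms by auto
  moreover have "s \<in> {x \<in> S. x < l}" "s \<notin> {x \<in> S. x < k}" using assms by auto
  ultimately have "{x \<in> S. x < k} \<subset> {x \<in> S. x < l}" by blast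
  then show ?thesis unfolding level_def using assms(1) by (intro psubset_card_mono) simp_all
qed

lemma level_Suc_notin:
  assumes "s \<notin> S"
  shows "level S (Suc s) = level S s"
proof -
  have "{x \<in> S. x < Suc s} = {x \<in> S. x < s}" using assms less_Suc_eq by auto
  then show ?thesis by (simp add: level_def)
qed

section \<open>Sorting blocks by \<open>P\<close>\<close>

lemma card_entries_le:
  assumes "bij_betw Q V {1..card V}" "k \<le> card V"
  shows "card {b \<in> V. Q b \<le> k} = k"
proof -
  have "Q ` {b \<in> V. Q b \<le> k} = Q ` V \<inter> {..k}" by auto
  also have "\<dots> = {1..k}" using assms by (auto simp: bij_betw_def)
  finally have "card (Q ` {b \<in> V. Q b \<le> k}) = k" by simp
  moreover have "inj_on Q {b \<in> V. Q b \<le> k}"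
    using assms(1) by (auto simp: bij_betw_def inj_on_def)
  ultimately show ?thesis by (simp add: card_image)
qed

text \<open>Inside a block there are no descents, so \<open>P\<close> increases along
  \<open>Q\<close>; sorting by block and then by \<open>P\<close> therefore restores the order of
  \<open>Q\<close>.\<close>

lemma lex_rank_blocks:
  assumes S: "finite S" and Q: "Q \<in> lin_exts V R" and D: "descents V P Q \<subseteq> S"
    and P: "inj_on P V"
  shows "lex_rank V P (blocks V S Q) = Q"
proof (rule extensionalityI)
  note Q = lin_extsD[OF Q]
  \<comment> \<open>A descent at \<open>l\<close> compares positions \<open>l\<close> and
    \<open>Suc l\<close>, so only the half-open range \<open>{k..<l}\<close> has to avoid
    \<open>S\<close>.\<close>
  have incr: "P (inv_into V Q k) \<le> P (inv_into V Q l)"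
    if "k \<le> l" "1 \<le> k" "l \<le> card V" "{k..<l} \<inter> S = {}" for k l
    using that
  proof (induction l rule: dec_induct)
    case (step l)
    then have "l \<notin> descents V P Q" using D by auto
    then have "P (inv_into V Q l) \<le> P (inv_into V Q (Suc l))"
      using step by (auto simp: descents_def)
    moreover have "P (inv_into V Q k) \<le> P (inv_into V Q l)"
      using step.prems by (intro step.IH) (auto simp: disjoint_iff)
    ultimately show ?case by simp
  qed simp
  have order: "level S (Q a) < level S (Q b) \<or> level S (Q a) = level S (Q b) \<and> P a \<le> P b"
    if "a \<in> V" "b \<in> V" "Q a \<le> Q b" for a b
  proof (cases "level S (Q a) < level S (Q b)")
    case False
    then have eq: "level S (Q a) = level S (Q b)"
      using level_mono[OF S \<open>Q a \<le> Q b\<close>] by simp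
    have "{Q a..<Q b} \<inter> S = {}"
      using False level_less[OF S] by fastforce
    moreover have "Q a \<in> {1..card V}" "Q b \<in> {1..card V}"
      using Q(4) that by auto
    ultimately have "P a \<le> P b"
      using incr[of "Q a" "Q b"] that by (simp add: inv_into_f_f[OF Q(3)])
    with eq show ?thesis by simp
  qed simp
  show "lex_rank V P (blocks V S Q) \<in> extensional V" by (simp add: lex_rank_def)
  show "Q \<in> extensional V" by (fact Q(1))
  fix a assume a: "a \<in> V"
  have "{b \<in> V. level S (Q b) < level S (Q a) \<or> level S (Q b) = level S (Q a) \<and> P b \<le> P a}
      = {b \<in> V. Q b \<le> Q a}"
  proof (intro Collect_cong conj_cong refl iffI)
    fix b assume b: "b \<in> V"
      and le: "level S (Q b) < level S (Q a) \<or> level S (Q b) = level S (Q a) \<and> P b \<le> P a"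
    show "Q b \<le> Q a"
    proof (rule ccontr)
      assume "\<not> Q b \<le> Q a"
      \<comment> \<open>Now \<open>a\<close> comes before \<open>b\<close> in \<open>Q\<close>, so
        \<open>order\<close> and \<open>le\<close> together leave only a tie in both block and
        \<open>P\<close>.\<close>
      then have "P a = P b" using order[OF a b] le by auto
      then have "a = b" using P a b by (auto dest: inj_onD)
      with \<open>\<not> Q b \<le> Q a\<close> show False by simp
    qed
  qed (use order a in auto)
  moreover have "Q a \<le> card V" using Q(4) a by auto
  ultimately show "lex_rank V P (blocks V S Q) a = Q a"
    using a card_entries_le[OF Q(2)]
    by (simp add: lex_rank_def blocks_def cong: conj_cong)
qed

lemma lex_rank_less:
  assumes "finite V" "a \<in> V" "b \<in> V" "f a < f b \<or> f a = f b \<and> P a < P b"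
  shows "lex_rank V P f a < lex_rank V P f b"
proof -
  have "{c \<in> V. f c < f a \<or> f c = f a \<and> P c \<le> P a}
      \<subset> {c \<in> V. f c < f b \<or> f c = f b \<and> P c \<le> P b}" (is "?A \<subset> ?B")
  proof
    show "?A \<subseteq> ?B" using assms by auto
    have "b \<in> ?B" "b \<notin> ?A" using assms by auto
    then show "?A \<noteq> ?B" by blast
  qed
  then have "card ?A < card ?B" using assms by (intro psubset_card_mono) auto
  then show ?thesis using assms by (simp add: lex_rank_def)
qed

lemma bij_betw_lex_rank:
  assumes "finite V" "inj_on P V"
  shows "bij_betw (lex_rank V P f) V {1..card V}"
proof -
  have inj: "inj_on (lex_rank V P f) V"
  proof (rule inj_onI, rule ccontr)
    fix a b assume ab: "a \<in> V" "b \<in> V" "lex_rank V P f a = lex_rank V P f b" "a \<noteq> b"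
    then have "P a \<noteq> P b" using assms(2) by (auto dest: inj_onD)
    then show False
      using lex_rank_less[OF assms(1), of a b f P] lex_rank_less[OF assms(1), of b a f P] ab
      by (metis less_irrefl linorder_less_linear)
  qed
  have "lex_rank V P f a \<in> {1..card V}" if a: "a \<in> V" for a
  proof -
    let ?A = "{b \<in> V. f b < f a \<or> f b = f a \<and> P b \<le> P a}"
    have "a \<in> ?A" using a by simp
    moreover have "finite ?A" using assms by simp
    ultimately have "0 < card ?A" using card_gt_0_iff by blast
    moreover have "card ?A \<le> card V" using assms by (intro card_mono) auto
    ultimately show ?thesis using a by (simp add: lex_rank_def)
  qed
  then have "lex_rank V P f ` V \<subseteq> {1..card V}" by blast
  then have "lex_rank V P f ` V = {1..card V}"
    by (intro card_subset_eq) (simp_all add: card_image inj)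
  with inj show ?thesis by (simp add: bij_betw_def)
qed

text \<open>The blocks of \<open>Q\<close> occupy consecutive intervals of positions whose lengths
  are the block sizes. Sorting goes through the blocks in the same order, so every node stays in its
  interval.\<close>

lemma blocks_lex_rank:
  assumes V: "finite V" and S: "finite S" and P: "inj_on P V" and Q: "Q \<in> lin_exts V R"
  shows "blocks V S (lex_rank V P (blocks V S Q)) = blocks V S Q" (is "blocks V S ?Q' = ?f")
proof (rule extensionalityI)
  note Q = lin_extsD[OF Q]
  show "blocks V S ?Q' \<in> extensional V" "?f \<in> extensional V" by (simp_all add: blocks_def)
  fix a assume a: "a \<in> V"
  have Q': "?Q' a \<in> {1..card V}"
    using bij_betw_lex_rank[OF V P] a by (rule bij_betw_apply)
  \<comment> \<open>The two numbers are compared through all thresholds \<open>m\<close>; choosing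
    each of them as \<open>m\<close> gives equality.\<close>
  have *: "level S (?Q' a) < m \<longleftrightarrow> ?f a < m" for m
  proof -
    let ?K = "{k \<in> {1..card V}. level S k < m}" and ?B = "{b \<in> V. ?f b < m}"
    \<comment> \<open>\<open>?K\<close> is an initial segment because \<open>level\<close> is
      monotone, and \<open>Q\<close> maps \<open>?B\<close> onto it, so \<open>j\<close> is the size
      of \<open>?B\<close>.\<close>
    obtain j where K: "?K = {1..j}"
    proof (cases "?K = {}")
      case True
      then have "?K = {1..0}" by simp
      then show thesis by (rule that)
    next
      case False
      define M where "M = Max ?K"
      have M: "M \<in> ?K" unfolding M_def by (rule Max_in) (use False in auto)
      have "?K = {1..M}"
      proof
        show "?K \<subseteq> {1..M}" unfolding M_def by (auto intro: Max_ge)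
        show "{1..M} \<subseteq> ?K" using M level_mono[OF S, of _ M] by fastforce
      qed
      then show thesis by (rule that)
    qed
    have "?K = Q ` ?B"
      unfolding Q(4)[symmetric] by (auto simp: blocks_def)
    moreover have "inj_on Q ?B" using Q(3) by (rule inj_on_subset) auto
    ultimately have "card {1..j} = card ?B" unfolding K by (metis card_image)
    moreover have "level S (?Q' a) < m \<longleftrightarrow> ?Q' a \<in> {1..j}"
      unfolding K[symmetric] using Q' by simp
    ultimately have "level S (?Q' a) < m \<longleftrightarrow> ?Q' a \<le> card ?B" using Q' by simp
    also have "\<dots> \<longleftrightarrow> ?f a < m"
    proof
      assume "?f a < m"
      \<comment> \<open>Whatever is ranked no later than \<open>a\<close> then lies in
        \<open>?B\<close>.\<close>
      then show "?Q' a \<le> card ?B"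
        using a V by (auto simp: lex_rank_def intro!: card_mono)
    next
      assume le: "?Q' a \<le> card ?B"
      show "?f a < m"
      proof (rule ccontr)
        assume "\<not> ?f a < m"
        \<comment> \<open>Here all of \<open>?B\<close> precedes \<open>a\<close>, and
          \<open>a\<close> counts itself, so its rank exceeds the size of \<open>?B\<close>.\<close>
        then have "insert a ?B \<subseteq> {b \<in> V. ?f b < ?f a \<or> ?f b = ?f a \<and> P b \<le> P a}"
          using a by auto
        then have "card (insert a ?B) \<le> ?Q' a"
          using a V by (auto simp: lex_rank_def intro!: card_mono)
        with le \<open>\<not> ?f a < m\<close> V show False by simp
      qed
    qed
    finally show ?thesis .
  qed
  have "level S (?Q' a) = ?f a"
    using *[of "level S (?Q' a)"] *[of "?f a"] by simp
  then show "blocks V S ?Q' a = ?f a" using a by (simp add: blocks_def)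
qed

text \<open>A related pair never has its blocks reversed, as \<open>Q\<close> respects
  \<open>R\<close>; a tie is decided correctly because \<open>P\<close> respects \<open>R\<close>
  too.\<close>

lemma lex_rank_in_lin_exts:
  assumes V: "finite V" and S: "finite S" and P: "P \<in> lin_exts V R" and Q: "Q \<in> lin_exts V R"
  shows "lex_rank V P (blocks V S Q) \<in> lin_exts V R"
  unfolding lin_exts_def
proof (intro CollectI conjI ballI impI)
  show "lex_rank V P (blocks V S Q) \<in> extensional V" by (simp add: lex_rank_def)
  show "bij_betw (lex_rank V P (blocks V S Q)) V {1..card V}"
    using bij_betw_lex_rank[OF V lin_extsD(3)[OF P]] .
  fix a b assume ab: "a \<in> V" "b \<in> V" "R a b"
  then have "Q a < Q b" "P a < P b" using lin_extsD(5)[OF Q] lin_extsD(5)[OF P] by auto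
  then show "lex_rank V P (blocks V S Q) a < lex_rank V P (blocks V S Q) b"
    using level_mono[OF S, of "Q a" "Q b"] ab
    by (intro lex_rank_less[OF V]) (auto simp: blocks_def)
qed

text \<open>Adjacent positions not separated by a cut share a block, and there sorting follows
  \<open>P\<close>.\<close>

lemma descents_lex_rank:
  assumes V: "finite V" and S: "finite S" and P: "P \<in> lin_exts V R" and Q: "Q \<in> lin_exts V R"
  shows "descents V P (lex_rank V P (blocks V S Q)) \<subseteq> S" (is "descents V P ?Q' \<subseteq> S")
proof
  fix k assume "k \<in> descents V P ?Q'"
  then have k: "1 \<le> k" "k < card V" "P (inv_into V ?Q' (Suc k)) < P (inv_into V ?Q' k)"
    by (auto simp: descents_def)
  define a b where "a = inv_into V ?Q' k" and "b = inv_into V ?Q' (Suc k)"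
  have im: "?Q' ` V = {1..card V}"
    using bij_betw_lex_rank[OF V lin_extsD(3)[OF P]] by (auto simp: bij_betw_def)
  then have mem: "k \<in> ?Q' ` V" "Suc k \<in> ?Q' ` V" using k by auto
  then have ab: "a \<in> V" "b \<in> V" "?Q' a = k" "?Q' b = Suc k"
    unfolding a_def b_def by (simp_all add: inv_into_into f_inv_into_f)
  have "P b < P a" using k by (simp add: a_def b_def)
  \<comment> \<open>Sorting keeps the blocks of \<open>Q\<close>, so they can be read off the new
    positions.\<close>
  have f: "blocks V S Q c = level S (?Q' c)" if "c \<in> V" for c
    using fun_cong[OF blocks_lex_rank[OF V S lin_extsD(3)[OF P] Q], of c] that
    by (simp add: blocks_def)
  show "k \<in> S"
  proof (rule ccontr)
    assume "k \<notin> S"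
    then have "blocks V S Q a = blocks V S Q b"
      using f ab by (simp add: level_Suc_notin)
    then have "?Q' b < ?Q' a"
      using ab(1,2) \<open>P b < P a\<close> by (intro lex_rank_less[OF V]) auto
    with ab show False by simp
  qed
qed

text \<open>The point is that the right-hand side is free of \<open>P\<close>. Its image is taken
  over all linear extensions, so surjectivity rests on sorting each decomposition by
  \<open>P\<close>.\<close>

lemma card_descents_subset:
  assumes V: "finite V" and S: "finite S" and P: "P \<in> lin_exts V R"
  shows "card {Q \<in> lin_exts V R. descents V P Q \<subseteq> S} = card (blocks V S ` lin_exts V R)"
proof (rule bij_betw_same_card)
  show "bij_betw (blocks V S) {Q \<in> lin_exts V R. descents V P Q \<subseteq> S} (blocks V S ` lin_exts V R)"
  proof (rule bij_betw_byWitness[where f' = "lex_rank V P"])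
    show "\<forall>Q \<in> {Q \<in> lin_exts V R. descents V P Q \<subseteq> S}. lex_rank V P (blocks V S Q) = Q"
      using lex_rank_blocks[OF S _ _ lin_extsD(3)[OF P]] by blast
    show "\<forall>f \<in> blocks V S ` lin_exts V R. blocks V S (lex_rank V P f) = f"
      using blocks_lex_rank[OF V S lin_extsD(3)[OF P]] by blast
    show "lex_rank V P ` blocks V S ` lin_exts V R \<subseteq> {Q \<in> lin_exts V R. descents V P Q \<subseteq> S}"
      using lex_rank_in_lin_exts[OF V S P] descents_lex_rank[OF V S P] by blast
  qed blast
qed

section \<open>Inclusion-exclusion over descent sets\<close>

lemma card_fibre_eqI:
  fixes d d' :: "'b \<Rightarrow> 'c set"
  assumes L: "finite L" and T: "finite T"
    and eq: "\<And>S. finite S \<Longrightarrow> card {x \<in> L. d x \<subseteq> S} = card {x \<in> L. d' x \<subseteq> S}"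
  shows "card {x \<in> L. d x = T} = card {x \<in> L. d' x = T}"
  using T
proof (induction T rule: finite_psubset_induct)
  case (psubset T)
  \<comment> \<open>Besides the fibre over \<open>T\<close> only fibres over proper subsets remain;
    these agree by induction, so equal counts for containment in \<open>T\<close> force equal counts
    for equality with \<open>T\<close>.\<close>
  have split: "card {x \<in> L. e x \<subseteq> T} =
      card {x \<in> L. e x = T} + (\<Sum>U\<in>Pow T - {T}. card {x \<in> L. e x = U})" for e :: "'b \<Rightarrow> 'c set"
  proof -
    have "{x \<in> L. e x \<subseteq> T} = (\<Union>U\<in>Pow T. {x \<in> L. e x = U})" by auto
    also have "card \<dots> = (\<Sum>U\<in>Pow T. card {x \<in> L. e x = U})"
      using L psubset.hyps by (intro card_UN_disjoint) auto
    finally show ?thesis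
      using sum.remove[of "Pow T" T "\<lambda>U. card {x \<in> L. e x = U}"] psubset.hyps by simp
  qed
  have "(\<Sum>U\<in>Pow T - {T}. card {x \<in> L. d x = U}) = (\<Sum>U\<in>Pow T - {T}. card {x \<in> L. d' x = U})"
    using psubset.IH by (intro sum.cong) auto
  then show ?case using split[of d] split[of d'] eq[OF psubset.hyps] by simp
qed

lemma sum_fibres:
  fixes g :: "'c \<Rightarrow> 'd :: comm_semiring_1"
  assumes "finite L" "finite U" "d ` L \<subseteq> U"
  shows "(\<Sum>x\<in>L. g (d x)) = (\<Sum>T\<in>U. of_nat (card {x \<in> L. d x = T}) * g T)"
proof -
  have "(\<Sum>x\<in>L. g (d x)) = (\<Sum>T\<in>U. \<Sum>x\<in>{x \<in> L. d x = T}. g (d x))"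
    by (rule sum.group[symmetric]) (use assms in auto)
  also have "\<dots> = (\<Sum>T\<in>U. \<Sum>x\<in>{x \<in> L. d x = T}. g T)"
    by (intro sum.cong) auto
  finally show ?thesis by simp
qed

text \<open>Grouped by descent set, both sums have the same coefficients.\<close>

lemma sum_descents_eq:
  fixes g :: "nat set \<Rightarrow> 'd :: comm_semiring_1"
  assumes V: "finite V" and P: "P \<in> lin_exts V R" and P': "P' \<in> lin_exts V R"
  shows "(\<Sum>Q\<in>lin_exts V R. g (descents V P Q)) = (\<Sum>Q\<in>lin_exts V R. g (descents V P' Q))"
proof -
  \<comment> \<open>Every descent is below \<open>card V\<close>, so the finite family
    \<open>?U\<close> serves \<open>P\<close> and \<open>P'\<close> at once.\<close>
  let ?L = "lin_exts V R" and ?U = "Pow {..<card V}"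
  have sub: "descents V p ` ?L \<subseteq> ?U" for p by (auto simp: descents_def)
  have "card {Q \<in> ?L. descents V P Q = T} = card {Q \<in> ?L. descents V P' Q = T}"
    if "T \<in> ?U" for T
    using that finite_subset[of T "{..<card V}"]
    by (intro card_fibre_eqI finite_lin_exts V)
      (auto simp: card_descents_subset[OF V _ P] card_descents_subset[OF V _ P'])
  then show ?thesis
    by (simp add: sum_fibres[OF finite_lin_exts[OF V] _ sub])
qed

section \<open>Young diagrams and pedestals\<close>

definition same_line_less :: "node \<Rightarrow> node \<Rightarrow> bool" where
  "same_line_less a b \<longleftrightarrow>
     snd a = snd b \<and> fst a < fst b \<or> fst a = fst b \<and> snd a < snd b"

text \<open>The assumption reconciles the two forms of the range of entries; the column and row
  conditions on tableaux are the two halves of \<open>same_line_less\<close>.\<close>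

lemma syt_eq_lin_exts:
  assumes "card (nodes lam) = sum_list lam"
  shows "syt lam = lin_exts (nodes lam) same_line_less"
proof -
  have "(\<forall>a\<in>nodes lam. \<forall>b\<in>nodes lam. same_line_less a b \<longrightarrow> Q a < Q b) \<longleftrightarrow>
    (\<forall>i i' j. (i, j) \<in> nodes lam \<longrightarrow> (i', j) \<in> nodes lam \<longrightarrow> i < i' \<longrightarrow> Q (i, j) < Q (i', j)) \<and>
    (\<forall>i j j'. (i, j) \<in> nodes lam \<longrightarrow> (i, j') \<in> nodes lam \<longrightarrow> j < j' \<longrightarrow> Q (i, j) < Q (i, j'))"
    for Q :: "node \<Rightarrow> nat"
    unfolding Ball_def split_paired_All same_line_less_def fst_conv snd_conv by blast
  then show ?thesis by (simp add: syt_def lin_exts_def assms)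
qed

lemma pedestal_eq_level:
  assumes card: "card (nodes lam) = sum_list lam"
    and Q: "bij_betw Q (nodes lam) {1..sum_list lam}" and a: "a \<in> nodes lam"
  shows "pedestal lam P Q a = level (descents (nodes lam) P Q) (Q a)"
proof -
  have le: "Q a \<le> sum_list lam" using Q a by (auto simp: bij_betw_def)
  \<comment> \<open>A disagreement node is defined through some position \<open>k\<close>;
    injectivity of the enumeration forces \<open>k\<close> to be the given \<open>l\<close>.\<close>
  have inj: "inv_into (nodes lam) Q k = inv_into (nodes lam) Q l \<longleftrightarrow> k = l"
    if "k \<in> {1..sum_list lam}" "l \<in> {1..sum_list lam}" for k l
    using that Q by (metis bij_betw_def inv_into_injective)
  have "{l. 1 \<le> l \<and> l < Q a \<and> disagreement_node lam P Q (nth_node lam Q l)}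
      = {l \<in> descents (nodes lam) P Q. l < Q a}"
    using le inj
    by (auto simp: disagreement_node_def nth_node_def prec_def descents_def card)
  then show ?thesis by (simp add: pedestal_def level_def)
qed

text \<open>Indexing the factors by position instead of node shows that the monomial depends on
  \<open>Q\<close> only through its descent set.\<close>

lemma prod_var_pedestal:
  assumes "card (nodes lam) = sum_list lam" "bij_betw Q (nodes lam) {1..sum_list lam}"
  shows "(\<Prod>a\<in>nodes lam. var (pedestal lam P Q a))
       = (\<Prod>k\<in>{1..sum_list lam}. var (level (descents (nodes lam) P Q) k))"
  by (subst prod.reindex_bij_betw[OF assms(2), symmetric])
    (rule prod.cong[OF refl], simp only: pedestal_eq_level[OF assms])

theorem theorem2:
  fixes n :: nat and lam :: "nat list" and P P' :: "node \<Rightarrow> nat"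
  assumes "n \<ge> 1" and "is_partition lam n"
    and "P \<in> syt lam" and "P' \<in> syt lam"
  shows "pedestal_poly lam P = pedestal_poly lam P'"
proof -
  \<comment> \<open>The bijection \<open>P\<close> itself supplies the finiteness and the size of
    the diagram.\<close>
  have P: "bij_betw P (nodes lam) {1..sum_list lam}" using assms(3) by (simp add: syt_def)
  then have V: "finite (nodes lam)" using bij_betw_finite by blast
  have card: "card (nodes lam) = sum_list lam" using bij_betw_same_card[OF P] by simp
  note L = syt_eq_lin_exts[OF card]
  define g :: "nat set \<Rightarrow> ipoly" where "g D = (\<Prod>k\<in>{1..sum_list lam}. var (level D k))" for D
  have "pedestal_poly lam p = (\<Sum>Q\<in>syt lam. g (descents (nodes lam) p Q))" for p
    unfolding pedestal_poly_def g_def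
    by (intro sum.cong refl prod_var_pedestal[OF card]) (simp add: syt_def)
  then show ?thesis
    using sum_descents_eq[OF V, of P same_line_less P' g] assms(3,4) unfolding L by simp
qed

end
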